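(* Let $X$ be a compact metric space, $m\in C(X,\mathbb{R}^{d\times d}_{\mathrm{psd}})$ and $M(\xi):=\int_X m(x)\,\mathrm{d}\xi(x)$ for $\xi\in\Xi(X)$. Let $\Psi:\mathbb{R}^{d\times d}_{\mathrm{psd}}\to\mathbb{R}\cup\{\infty\}$ be strictly convex and lower semicontinuous with $\Xi_{\mathrm{fin}}(X)\ne\emptyset$, and suppose that $\Psi|_{\operatorname{dom}\Psi}$ is directionally differentiable w.r.t. $M(\Xi(X))$ with a continuous sensitivity function $\psi:\operatorname{dom}\Psi\times X\to\mathbb{R}$. Let $X^0$ be a finite subset of $X$ with $\Xi_{\mathrm{fin}}(X^0)\neq\emptyset$, and let $(\xi^k)_{k\in K}$ be generated by the strict or by the relaxed algorithm with exchange, with initial discretization $X^0$ and optimality tolerances $\varepsilon>0$ and $\overline{\delta}_k,\underline{\delta}_k\in[0,\infty)$ such that $(\overline{\delta}_k)$ is summable and $\varepsilon>\underline{\delta}:=\limsup_{k\to\infty}\underline{\delta}_k$. Then $(\xi^k)$ terminates at an $\varepsilon$-optimal design for $\Psi\circ M$.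
   Context: Let $d\in\mathbb{N}$; $\mathbb{R}^{d\times d}_{\mathrm{psd}}$ is the set of (symmetric) positive semidefinite real $d\times d$ matrices. $\Xi(X)$ is the set of Borel probability measures (designs) on $X$; for a finite $X'\subset X$, $\Xi(X')$ is identified with the designs on $X$ supported in $X'$. $\operatorname{supp}\xi$ is the support of $\xi$. $\operatorname{dom}\Psi:=\{M:\Psi(M)<\infty\}$, and for $X'\subset X$, $\Xi_{\mathrm{fin}}(X'):=\{\xi\in\Xi(X'):\Psi(M(\xi))<\infty\}$. Strict convexity of $\Psi$ means that $\operatorname{dom}\Psi$ is convex and the real-valued restriction $\Psi|_{\operatorname{dom}\Psi}$ is strictly convex. A design $\xi^*\in\Xi(X)$ is $\varepsilon$-optimal for $\Psi\circ M$ iff $\Psi(M(\xi^* ))\le\inf_{\xi\in\Xi(X)}\Psi(M(\xi))+\varepsilon$. A $\delta$-approximate solution of a minimization problem is a feasible point whose objective value is at most the infimum plus $\delta$. A function $\psi:\operatorname{dom}\Psi\times X\to\mathbb{R}$ is a sensitivity function of $\Psi|_{\operatorname{dom}\Psi}$ w.r.t. $M(\Xi(X))$ iff for all $M\in\operatorname{dom}\Psi$ and $\eta\in\Xi(X)$, $\psi(M,\cdot)$ is $\eta$-integrable and $\frac{\Psi(M+t(M(\eta)-M))-\Psi(M)}{t}\to\int_X\psi(M,x)\,\mathrm{d}\eta(x)$ as $t\searrow0$. $\Psi|_{\operatorname{dom}\Psi}$ is directionally differentiable w.r.t. $M(\Xi(X))$ iff such a (necessarily unique) $\psi$ exists. Strict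 algorithm with exchange. Input: finite $X^0\subset X$, tolerances $\varepsilon,\overline{\delta}_k,\underline{\delta}_k\in[0,\infty)$ ($k\in\mathbb{N}_0$). Start with $k=0$. Step 1: compute a $\overline{\delta}_k$-approximate solution $\xi^k\in\Xi(X^k)$ of $\min_{\xi\in\Xi(X^k)}\Psi(M(\xi))$. Step 2: compute a $\underline{\delta}_k$-approximate solution $x^k\in X$ of $\min_{x\in X}\psi(M(\xi^k),x)$. If $\psi(M(\xi^k),x^k)<-\varepsilon+\underline{\delta}_k$, set $X^{k+1}:=\operatorname{supp}\xi^k\cup\{x^k\}$ and return to Step 1 with $k+1$ in place of $k$; if $\psi(M(\xi^k),x^k)\ge-\varepsilon+\underline{\delta}_k$, terminate. Relaxed algorithm with exchange. Input: finite $X^0\subset X$, tolerances $\varepsilon,\overline{\delta}_k\in[0,\infty)$ (the $\underline{\delta}_k$ are not used by the algorithm). Same Step 1. Step 2: search for a point $x^k\in\{x\in X:\psi(M(\xi^k),x)<-\varepsilon\}$; if such a point is found, set $X^{k+1}:=\operatorname{supp}\xi^k\cup\{x^k\}$ and return to Step 1 with $k+1$; if this set is empty, terminate. $K$ is the set of iteration indices: $K=\{0,\dots,k^*\}$ if the algorithm terminates in iteration $k^*$ (then the sequence is said to terminate at $\xi^{k^*}$), and $K=\mathbb{N}_0$ if it does not terminate. *)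

theory Defs
  imports "HOL-Probability.Probability"
begin

definition psd_matrices :: "(real^'n^'n) set" where
  "psd_matrices = {A. transpose A = A \<and> (\<forall>v. 0 \<le> v \<bullet> (A *v v))}"

definition designs :: "'a::metric_space set \<Rightarrow> 'a measure set" where
  "designs X = {\<xi>. prob_space \<xi> \<and> sets \<xi> = sets (restrict_space borel X)}"

text \<open>For \<open>\<xi> \<in> designs X\<close>, the sets \<open>U \<inter> X\<close> with \<open>U\<close> open are the relatively open subsets of \<open>X\<close>.\<close>

definition design_supp :: "'a::metric_space set \<Rightarrow> 'a measure \<Rightarrow> 'a set" where
  "design_supp X \<xi> = {x \<in> X. \<forall>U. open U \<and> x \<in> U \<longrightarrow> emeasure \<xi> (U \<inter> X) > 0}"

text \<open>For finite \<open>X' \<subseteq> X\<close>, a design on \<open>X'\<close> is a measure on the whole of \<open>X\<close>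
  that is supported in \<open>X'\<close>. Moreover, \<open>designs_in X X = designs X\<close>.\<close>

definition designs_in :: "'a::metric_space set \<Rightarrow> 'a set \<Rightarrow> 'a measure set" where
  "designs_in X X' = {\<xi> \<in> designs X. design_supp X \<xi> \<subseteq> X'}"

definition info_matrix :: "('a \<Rightarrow> real^'n^'n) \<Rightarrow> 'a measure \<Rightarrow> real^'n^'n" where
  "info_matrix m \<xi> = (LINT x|\<xi>. m x)"

text \<open>A criterion on the psd matrices with values in \<open>\<real> \<union> {\<infinity>}\<close> is represented by a total
  function into \<^typ>\<open>ereal\<close>; its values outside \<^const>\<open>psd_matrices\<close> play no role.\<close>

definition crit_dom :: "(real^'n^'n \<Rightarrow> ereal) \<Rightarrow> (real^'n^'n) set" where
  "crit_dom \<Psi> = {M \<in> psd_matrices. \<Psi> M < \<infinity>}"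

definition strictly_convex_crit :: "(real^'n^'n \<Rightarrow> ereal) \<Rightarrow> bool" where
  "strictly_convex_crit \<Psi> \<longleftrightarrow> convex (crit_dom \<Psi>) \<and>
     (\<forall>A\<in>crit_dom \<Psi>. \<forall>B\<in>crit_dom \<Psi>. \<forall>t::real. A \<noteq> B \<and> 0 < t \<and> t < 1 \<longrightarrow>
        real_of_ereal (\<Psi> ((1 - t) *\<^sub>R A + t *\<^sub>R B))
          < (1 - t) * real_of_ereal (\<Psi> A) + t * real_of_ereal (\<Psi> B))"

definition lsc_crit :: "(real^'n^'n \<Rightarrow> ereal) \<Rightarrow> bool" where
  "lsc_crit \<Psi> \<longleftrightarrow> (\<forall>M\<in>psd_matrices. \<Psi> M \<le> Liminf (at M within psd_matrices) \<Psi>)"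

definition designs_fin ::
  "'a::metric_space set \<Rightarrow> ('a \<Rightarrow> real^'n^'n) \<Rightarrow> (real^'n^'n \<Rightarrow> ereal) \<Rightarrow> 'a set \<Rightarrow> 'a measure set" where
  "designs_fin X m \<Psi> X' = {\<xi> \<in> designs_in X X'. \<Psi> (info_matrix m \<xi>) < \<infinity>}"

text \<open>The difference quotient is taken in the extended reals, since \<open>\<Psi>\<close> may be infinite
  off its domain; convergence to a real number forces it to be finite for all small \<open>t > 0\<close>.\<close>

definition sensitivity_function ::
  "'a::metric_space set \<Rightarrow> ('a \<Rightarrow> real^'n^'n) \<Rightarrow> (real^'n^'n \<Rightarrow> ereal)
     \<Rightarrow> (real^'n^'n \<Rightarrow> 'a \<Rightarrow> real) \<Rightarrow> bool" where
  "sensitivity_function X m \<Psi> \<psi> \<longleftrightarrow>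
     (\<forall>M\<in>crit_dom \<Psi>. \<forall>\<eta>\<in>designs X.
        integrable \<eta> (\<psi> M) \<and>
        ((\<lambda>t. (\<Psi> (M + t *\<^sub>R (info_matrix m \<eta> - M)) - \<Psi> M) / ereal t)
           \<longlongrightarrow> ereal (LINT x|\<eta>. \<psi> M x)) (at_right 0))"

definition approx_solution :: "('b \<Rightarrow> ereal) \<Rightarrow> 'b set \<Rightarrow> real \<Rightarrow> 'b \<Rightarrow> bool" where
  "approx_solution f S \<delta> y \<longleftrightarrow> y \<in> S \<and> f y \<le> (INF z\<in>S. f z) + ereal \<delta>"

definition eps_optimal_design ::
  "'a::metric_space set \<Rightarrow> ('a \<Rightarrow> real^'n^'n) \<Rightarrow> (real^'n^'n \<Rightarrow> ereal)
     \<Rightarrow> real \<Rightarrow> 'a measure \<Rightarrow> bool" where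
  "eps_optimal_design X m \<Psi> \<epsilon> \<xi> \<longleftrightarrow> \<xi> \<in> designs X \<and>
     \<Psi> (info_matrix m \<xi>) \<le> (INF \<eta>\<in>designs X. \<Psi> (info_matrix m \<eta>)) + ereal \<epsilon>"

text \<open>In the two predicates below, \<open>K\<close> is the set of iteration indices of the run, \<open>Xs k\<close> is the
  discretization and \<open>x k\<close> the point used in iteration \<open>k\<close>. \<open>K\<close> is an initial segment
  of the naturals that continues past \<open>k\<close> exactly if the algorithm does not terminate in
  iteration \<open>k\<close>; so \<open>K\<close> is \<open>{..k}\<close> if it terminates in iteration \<open>k\<close>, and \<^const>\<open>UNIV\<close> if it
  never terminates. The sequence \<open>\<xi>\<close> is unconstrained outside \<open>K\<close>.\<close>

definition strict_exchange_run ::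
  "'a::metric_space set \<Rightarrow> ('a \<Rightarrow> real^'n^'n) \<Rightarrow> (real^'n^'n \<Rightarrow> ereal)
     \<Rightarrow> (real^'n^'n \<Rightarrow> 'a \<Rightarrow> real) \<Rightarrow> 'a set \<Rightarrow> real \<Rightarrow> (nat \<Rightarrow> real) \<Rightarrow> (nat \<Rightarrow> real)
     \<Rightarrow> nat set \<Rightarrow> (nat \<Rightarrow> 'a measure) \<Rightarrow> bool" where
  "strict_exchange_run X m \<Psi> \<psi> X0 \<epsilon> \<delta>u \<delta>l K \<xi> \<longleftrightarrow>
     (\<exists>Xs x. Xs 0 = X0 \<and> 0 \<in> K \<and> (\<forall>k. Suc k \<in> K \<longrightarrow> k \<in> K) \<and>
        (\<forall>k\<in>K.
           approx_solution (\<lambda>\<eta>. \<Psi> (info_matrix m \<eta>)) (designs_in X (Xs k)) (\<delta>u k) (\<xi> k) \<and>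
           approx_solution (\<lambda>y. ereal (\<psi> (info_matrix m (\<xi> k)) y)) X (\<delta>l k) (x k) \<and>
           (if \<psi> (info_matrix m (\<xi> k)) (x k) < - \<epsilon> + \<delta>l k
            then Suc k \<in> K \<and> Xs (Suc k) = design_supp X (\<xi> k) \<union> {x k}
            else Suc k \<notin> K)))"

definition relaxed_exchange_run ::
  "'a::metric_space set \<Rightarrow> ('a \<Rightarrow> real^'n^'n) \<Rightarrow> (real^'n^'n \<Rightarrow> ereal)
     \<Rightarrow> (real^'n^'n \<Rightarrow> 'a \<Rightarrow> real) \<Rightarrow> 'a set \<Rightarrow> real \<Rightarrow> (nat \<Rightarrow> real)
     \<Rightarrow> nat set \<Rightarrow> (nat \<Rightarrow> 'a measure) \<Rightarrow> bool" where
  "relaxed_exchange_run X m \<Psi> \<psi> X0 \<epsilon> \<delta>u K \<xi> \<longleftrightarrow>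
     (\<exists>Xs x. Xs 0 = X0 \<and> 0 \<in> K \<and> (\<forall>k. Suc k \<in> K \<longrightarrow> k \<in> K) \<and>
        (\<forall>k\<in>K.
           approx_solution (\<lambda>\<eta>. \<Psi> (info_matrix m \<eta>)) (designs_in X (Xs k)) (\<delta>u k) (\<xi> k) \<and>
           (if {y \<in> X. \<psi> (info_matrix m (\<xi> k)) y < - \<epsilon>} \<noteq> {}
            then x k \<in> {y \<in> X. \<psi> (info_matrix m (\<xi> k)) y < - \<epsilon>} \<and>
                 Suc k \<in> K \<and> Xs (Suc k) = design_supp X (\<xi> k) \<union> {x k}
            else Suc k \<notin> K)))"

end

theory Submission
  imports Defs
begin

text \<open>
  The objective values \<open>f k = \<Psi> (M (\<xi> k))\<close> almost decrease: the next discretization contains the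
  support of \<open>\<xi> k\<close>, so \<open>\<xi> k\<close> itself competes in the next problem and
  \<open>f (k + 1) \<le> f k + \<delta> (k + 1)\<close>. More generally, every mixture \<open>(1 - t) \<xi> k + t \<delta>\<^sub>x\<close> of \<open>\<xi> k\<close> with the
  point mass at the added point \<open>x = x k\<close> competes, so \<open>f (k + 1)\<close> is, up to \<open>\<delta> (k + 1)\<close>, at most the
  value of \<open>\<Psi>\<close> at any point of the segment from \<open>M (\<xi> k)\<close> to \<open>m x\<close>
  (\<open>exchange_step_le\<close>).

  If the algorithm never stops, the sensitivity \<open>\<psi> (M (\<xi> k)) (x k)\<close>, which is the slope of \<open>\<Psi>\<close> at
  the start of that segment, is eventually at most some \<open>- c < 0\<close>. By compactness a subsequence of
  the pairs \<open>(M (\<xi> k), x k)\<close> converges. Since \<open>f\<close> is bounded above, lower semicontinuity puts the limit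
  of the matrices into the domain of \<open>\<Psi>\<close>. There \<open>\<psi>\<close> is continuous, so the slope stays below
  \<open>- c / 2\<close> on an initial piece of the segment whose length does not depend on \<open>k\<close>
  (\<open>uniform_descent\<close>). Hence \<open>f\<close> drops by a fixed positive amount infinitely often, while it
  rises by no more than the finite sum of the tolerances in total; so \<open>f\<close> tends to \<open>- \<infinity>\<close> along the
  subsequence, against the lower semicontinuity of \<open>\<Psi>\<close> at the limit matrix
  (\<open>no_infinite_exchange\<close>).

  When the algorithm stops, all sensitivities are at least \<open>- \<epsilon>\<close>. By convexity the
  directional derivative towards any design \<open>\<eta>\<close>, which is the \<open>\<eta>\<close>-average of the sensitivities,
  bounds \<open>\<Psi> (M \<eta>) - \<Psi> (M (\<xi> k))\<close> from below, and \<open>\<epsilon>\<close>-optimality follows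
  (\<open>eps_optimal_if_sens_bounded_below\<close>).
\<close>

section \<open>The cone of positive semidefinite matrices\<close>

text \<open>The matrices \<open>v v\<^sup>T\<close> test nonnegativity of the quadratic form. The skew matrices, which come with
  both signs, turn symmetry into inequalities as well, so that the psd matrices become an
  intersection of halfspaces through the origin: closedness, convexity and stability under
  integration can then be read off one halfspace at a time.\<close>

definition psd_dual_generators :: "(real^'n^'n) set" where
  "psd_dual_generators = range (\<lambda>v. \<chi> i j. v $ i * v $ j)
     \<union> range (\<lambda>(i, j). axis i (axis j 1) - axis j (axis i 1))"

lemma psd_iff_dual_generators:
  "A \<in> psd_matrices \<longleftrightarrow> (\<forall>C\<in>psd_dual_generators. 0 \<le> C \<bullet> A)"
proof -
  have quad: "(\<chi> i j. v $ i * v $ j) \<bullet> A = v \<bullet> (A *v v)" for v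
    by (simp add: inner_vec_def matrix_vector_mult_def sum_distrib_left algebra_simps)
  have skew: "(axis i (axis j 1) - axis j (axis i 1)) \<bullet> A = A $ i $ j - A $ j $ i" for i j
    by (simp add: inner_diff_left inner_axis' inner_axis)
  have "transpose A = A \<longleftrightarrow> (\<forall>i j. 0 \<le> A $ i $ j - A $ j $ i)"
    by (auto simp: transpose_def vec_eq_iff intro: order.antisym)
  then show ?thesis
    by (auto simp: psd_matrices_def psd_dual_generators_def ball_Un quad skew)
qed

lemma psd_matrices_eq_Inter_halfspaces:
  "psd_matrices = (\<Inter>C\<in>psd_dual_generators. {A. C \<bullet> A \<ge> 0})"
  using psd_iff_dual_generators by blast

lemma closed_psd_matrices: "closed psd_matrices"
  unfolding psd_matrices_eq_Inter_halfspaces by (intro closed_INT ballI closed_halfspace_ge)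

lemma convex_psd_matrices: "convex psd_matrices"
  unfolding psd_matrices_eq_Inter_halfspaces by (intro convex_INT convex_halfspace_ge)

lemma segment_psd:
  assumes "A \<in> psd_matrices" "B \<in> psd_matrices" "0 \<le> t" "t \<le> 1"
  shows "A + t *\<^sub>R (B - A) \<in> psd_matrices"
  using convexD_alt[OF convex_psd_matrices assms] by (simp add: algebra_simps)

section \<open>Designs and their mixtures\<close>

lemma sets_design: "\<eta> \<in> designs X \<Longrightarrow> sets \<eta> = sets (restrict_space borel X)"
  unfolding designs_def by blast

lemma prob_space_design: "\<eta> \<in> designs X \<Longrightarrow> prob_space \<eta>"
  unfolding designs_def by blast

lemma space_design: "\<eta> \<in> designs X \<Longrightarrow> space \<eta> = X"
  using sets_eq_imp_space_eq[OF sets_design] by (simp only: space_restrict_space space_borel Int_UNIV_right)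

lemma integrable_design:
  fixes f :: "'a::metric_space \<Rightarrow> 'b::{banach, second_countable_topology}"
  assumes "compact X" "continuous_on X f" "\<eta> \<in> designs X"
  shows "integrable \<eta> f"
proof -
  interpret prob_space \<eta> using assms(3) by (rule prob_space_design)
  obtain B where "\<And>x. x \<in> X \<Longrightarrow> norm (f x) \<le> B"
    using compact_imp_bounded[OF compact_continuous_image[OF assms(2,1)]]
    by (auto simp: bounded_iff)
  moreover have "f \<in> borel_measurable \<eta>"
    using borel_measurable_continuous_on_restrict[OF assms(2)] measurable_cong_sets[OF sets_design[OF assms(3)] refl]
    by blast
  ultimately show ?thesis
    by (intro integrable_const_bound[where B = B] AE_I2) (simp_all only: space_design[OF assms(3)])
qed

text \<open>A nonnegative linear functional of \<open>m\<close> has a nonnegative integral.\<close>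

lemma info_matrix_psd:
  fixes m :: "'a::metric_space \<Rightarrow> real^'n^'n"
  assumes "compact X" "continuous_on X m" "m ` X \<subseteq> psd_matrices" "\<eta> \<in> designs X"
  shows "info_matrix m \<eta> \<in> psd_matrices"
  unfolding psd_iff_dual_generators
proof
  fix C :: "real^'n^'n"
  assume C: "C \<in> psd_dual_generators"
  have "C \<bullet> info_matrix m \<eta> = (LINT x|\<eta>. C \<bullet> m x)"
    using integrable_design[OF assms(1,2,4)] by (simp add: info_matrix_def)
  moreover have "0 \<le> (LINT x|\<eta>. C \<bullet> m x)"
    using assms(3) C space_design[OF assms(4)]
    by (intro Bochner_Integration.integral_nonneg) (auto simp: psd_iff_dual_generators)
  ultimately show "0 \<le> C \<bullet> info_matrix m \<eta>" by simp
qed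

lemma norm_info_matrix_le:
  fixes m :: "'a::metric_space \<Rightarrow> real^'n^'n"
  assumes "compact X" "continuous_on X m" "\<eta> \<in> designs X" "\<And>x. x \<in> X \<Longrightarrow> norm (m x) \<le> B"
  shows "norm (info_matrix m \<eta>) \<le> B"
proof -
  interpret prob_space \<eta> using assms(3) by (rule prob_space_design)
  have int: "integrable \<eta> m" using integrable_design[OF assms(1,2,3)] .
  have "norm (info_matrix m \<eta>) \<le> (LINT x|\<eta>. norm (m x))"
    unfolding info_matrix_def by (rule integral_norm_bound)
  also have "\<dots> \<le> (LINT x|\<eta>. B)"
  proof (rule integral_mono)
    show "integrable \<eta> (\<lambda>x. norm (m x))" using int by (rule integrable_norm)
    show "norm (m x) \<le> B" if "x \<in> space \<eta>" for x
      using that assms(4) space_design[OF assms(3)] by blast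
  qed (rule integrable_const)
  also have "\<dots> = B" using prob_space by (simp only: lebesgue_integral_const scaleR_one)
  finally show ?thesis .
qed

lemma design_in_subprob_algebra:
  assumes "\<eta> \<in> designs X"
  shows "\<eta> \<in> space (subprob_algebra (restrict_space borel X))"
proof -
  have "subprob_space \<eta>"
    using assms prob_space_imp_subprob_space unfolding designs_def by blast
  moreover have "sets \<eta> = sets (restrict_space borel X)"
    using assms unfolding designs_def by blast
  ultimately show ?thesis unfolding space_subprob_algebra by blast
qed

text \<open>Choosing between \<open>\<eta>\<close> and \<open>\<xi>\<close> by the toss of a coin with success probability \<open>t\<close> realizes the
  convex combination \<open>(1 - t) \<xi> + t \<eta>\<close> as a monadic bind, so that its values and integrals are
  expectations over the coin.\<close>

definition mixture :: "real \<Rightarrow> 'a measure \<Rightarrow> 'a measure \<Rightarrow> 'a measure" where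
  "mixture t \<xi> \<eta> = measure_pmf (bernoulli_pmf t) \<bind> (\<lambda>b. if b then \<eta> else \<xi>)"

context
  fixes X :: "'a::metric_space set" and \<xi> \<eta> :: "'a measure" and t :: real
  assumes designs: "\<xi> \<in> designs X" "\<eta> \<in> designs X" and t: "0 \<le> t" "t \<le> 1"
begin

lemma mixture_kernel:
  "(\<lambda>b. if b then \<eta> else \<xi>) \<in>
     measurable (measure_pmf (bernoulli_pmf t)) (subprob_algebra (restrict_space borel X))"
proof -
  have "(if b then \<eta> else \<xi>) \<in> space (subprob_algebra (restrict_space borel X))" for b
    using designs by (cases b) (simp_all only: if_True if_False design_in_subprob_algebra)
  then show ?thesis unfolding measurable_pmf_measure1 by (intro Pi_I)
qed

lemma emeasure_mixture:
  assumes "A \<in> sets (restrict_space borel X)"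
  shows "emeasure (mixture t \<xi> \<eta>) A = emeasure \<eta> A * ennreal t + emeasure \<xi> A * ennreal (1 - t)"
  unfolding mixture_def using t
  by (subst emeasure_bind[OF _ mixture_kernel assms]) (auto)

lemma mixture_in_designs: "mixture t \<xi> \<eta> \<in> designs X"
proof -
  have "prob_space (mixture t \<xi> \<eta>)" unfolding mixture_def
    using designs
    by (intro prob_space.prob_space_bind[OF prob_space_measure_pmf _ mixture_kernel])
       (auto simp: designs_def)
  moreover have "sets (mixture t \<xi> \<eta>) = sets (restrict_space borel X)"
    unfolding mixture_def using designs by (intro sets_bind) (auto simp: designs_def)
  ultimately show ?thesis by (simp add: designs_def)
qed

lemma integral_mixture:
  fixes f :: "'a \<Rightarrow> real"
  assumes "compact X" "continuous_on X f"
  shows "(LINT x|mixture t \<xi> \<eta>. f x) = (1 - t) * (LINT x|\<xi>. f x) + t * (LINT x|\<eta>. f x)"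
proof -
  obtain B where B: "\<And>x. x \<in> X \<Longrightarrow> \<bar>f x\<bar> \<le> B"
    using compact_imp_bounded[OF compact_continuous_image[OF assms(2,1)]]
    by (auto simp: bounded_iff)
  have "(LINT x|mixture t \<xi> \<eta>. f x) =
      (LINT b|measure_pmf (bernoulli_pmf t). LINT x|(if b then \<eta> else \<xi>). f x)"
    unfolding mixture_def
  proof (rule integral_bind[OF borel_measurable_continuous_on_restrict[OF assms(2)] _ mixture_kernel])
    show "\<bar>f x\<bar> \<le> B" if "x \<in> space (restrict_space borel X)" for x
      using that B by (simp add: space_restrict_space)
    show "AE b in measure_pmf (bernoulli_pmf t).
        emeasure (if b then \<eta> else \<xi>) (space (if b then \<eta> else \<xi>)) \<le> ennreal 1"
      using designs by (auto simp: designs_def prob_space.emeasure_space_1)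
  qed (rule prob_space.finite_measure[OF prob_space_measure_pmf])
  then show ?thesis using t by simp
qed

text \<open>Testing with an arbitrary matrix \<open>C\<close> in the inner product reduces the claim to real integrands.\<close>

lemma info_matrix_mixture:
  fixes m :: "'a \<Rightarrow> real^'n^'n"
  assumes "compact X" "continuous_on X m"
  shows "info_matrix m (mixture t \<xi> \<eta>) =
    info_matrix m \<xi> + t *\<^sub>R (info_matrix m \<eta> - info_matrix m \<xi>)"
proof -
  have "info_matrix m (mixture t \<xi> \<eta>) \<bullet> C =
      (info_matrix m \<xi> + t *\<^sub>R (info_matrix m \<eta> - info_matrix m \<xi>)) \<bullet> C" for C
  proof -
    have eq: "info_matrix m \<mu> \<bullet> C = (LINT x|\<mu>. m x \<bullet> C)" if "\<mu> \<in> designs X" for \<mu>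
      using integrable_design[OF assms that] by (simp add: info_matrix_def)
    have "continuous_on X (\<lambda>x. m x \<bullet> C)"
      using assms(2) by (intro continuous_intros)
    then show ?thesis
      by (simp add: eq designs mixture_in_designs integral_mixture[OF assms(1)]
          inner_add_left inner_diff_left algebra_simps)
  qed
  then show ?thesis using vector_eq_rdot by blast
qed

text \<open>Around a point outside both supports, the intersection of a null neighbourhood of each
  design is a null neighbourhood of the mixture.\<close>

lemma design_supp_mixture:
  "design_supp X (mixture t \<xi> \<eta>) \<subseteq> design_supp X \<xi> \<union> design_supp X \<eta>"
proof (rule ccontr)
  assume "\<not> ?thesis"
  then obtain y where y: "y \<in> design_supp X (mixture t \<xi> \<eta>)"
    and not_y: "y \<notin> design_supp X \<xi>" "y \<notin> design_supp X \<eta>"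
    by blast
  then have "y \<in> X" by (simp add: design_supp_def)
  then obtain U V where U: "open U" "y \<in> U" "emeasure \<xi> (U \<inter> X) = 0"
    and V: "open V" "y \<in> V" "emeasure \<eta> (V \<inter> X) = 0"
    using not_y by (simp add: design_supp_def not_gr_zero) blast
  have sets: "W \<inter> X \<in> sets (restrict_space borel X)" if "open W" for W
    using that by (auto simp: sets_restrict_space)
  have "emeasure \<xi> (U \<inter> V \<inter> X) \<le> emeasure \<xi> (U \<inter> X)"
    using sets[OF U(1)] sets_design[OF designs(1)] by (intro emeasure_mono) auto
  moreover have "emeasure \<eta> (U \<inter> V \<inter> X) \<le> emeasure \<eta> (V \<inter> X)"
    using sets[OF V(1)] sets_design[OF designs(2)] by (intro emeasure_mono) auto
  ultimately have "emeasure (mixture t \<xi> \<eta>) (U \<inter> V \<inter> X) = 0"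
    using U V by (subst emeasure_mixture) (auto simp: sets open_Int)
  moreover have "open (U \<inter> V)" "y \<in> U \<inter> V" using U V by auto
  ultimately show False using y unfolding design_supp_def by force
qed

end

definition point_design :: "'a::metric_space set \<Rightarrow> 'a \<Rightarrow> 'a measure" where
  "point_design X x = return (restrict_space borel X) x"

lemma point_design_in_designs: "x \<in> X \<Longrightarrow> point_design X x \<in> designs X"
  by (auto simp: point_design_def designs_def space_restrict_space intro!: prob_space_return)

lemma integral_point_design:
  fixes f :: "'a::metric_space \<Rightarrow> 'b::{banach, second_countable_topology}"
  assumes "x \<in> X" "f \<in> borel_measurable (restrict_space borel X)"
  shows "(LINT y|point_design X x. f y) = f x"
  unfolding point_design_def using assms by (intro integral_return) (auto simp: space_restrict_space)

lemma design_supp_point_design: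
  assumes "x \<in> X"
  shows "design_supp X (point_design X x) \<subseteq> {x}"
proof
  fix y assume y: "y \<in> design_supp X (point_design X x)"
  have "emeasure (point_design X x) ((- {x}) \<inter> X) = 0"
    using assms unfolding point_design_def
    by (subst emeasure_return) (auto simp: sets_restrict_space)
  then have "y \<notin> - {x}"
    using y by (force simp: design_supp_def)
  then show "y \<in> {x}" by simp
qed

section \<open>The criterion along segments\<close>

text \<open>The punctured lower limit in \<^const>\<open>lsc_crit\<close> together with the value at \<open>M\<close> itself
  controls a full neighbourhood.\<close>

lemma lsc_crit_nhds:
  assumes "lsc_crit \<Psi>" "M \<in> psd_matrices" "y < \<Psi> M"
  shows "eventually (\<lambda>N. N \<in> psd_matrices \<longrightarrow> y < \<Psi> N) (nhds M)"
proof -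
  have "y < Liminf (at M within psd_matrices) \<Psi>"
    using assms by (auto simp: lsc_crit_def intro: less_le_trans)
  then have "eventually (\<lambda>N. y < \<Psi> N) (at M within psd_matrices)"
    by (rule less_LiminfD)
  then show ?thesis
    unfolding eventually_at_filter
    by eventually_elim (use assms(3) in auto)
qed

lemma lsc_crit_sequentially:
  assumes "lsc_crit \<Psi>" "M \<in> psd_matrices" "y < \<Psi> M"
    and "N \<longlonglongrightarrow> M" "\<And>k. N k \<in> psd_matrices"
  shows "eventually (\<lambda>k. y < \<Psi> (N k)) sequentially"
  using eventually_compose_filterlim[OF lsc_crit_nhds[OF assms(1-3)] assms(4)] assms(5) by simp

lemma crit_dom_real:
  assumes "\<forall>M\<in>psd_matrices. \<Psi> M \<noteq> -\<infinity>" "M \<in> crit_dom \<Psi>"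
  shows "\<Psi> M = ereal (real_of_ereal (\<Psi> M))"
  using assms by (cases "\<Psi> M") (auto simp: crit_dom_def)

text \<open>A slope below \<open>c\<close> forces the line of slope \<open>c\<close> to lie above \<open>\<Psi>\<close> for all small steps;
  in particular \<open>\<Psi>\<close> is finite there.\<close>

lemma crit_quotient_eventually_less:
  assumes proper: "\<forall>M\<in>psd_matrices. \<Psi> M \<noteq> -\<infinity>" and A: "A \<in> crit_dom \<Psi>"
    and lim: "((\<lambda>t. (\<Psi> (A + t *\<^sub>R D) - \<Psi> A) / ereal t) \<longlongrightarrow> ereal l) (at_right 0)" and "l < c"
  shows "eventually (\<lambda>t. \<Psi> (A + t *\<^sub>R D) < \<Psi> A + ereal (c * t)) (at_right 0)"
proof -
  obtain a where a: "\<Psi> A = ereal a" using crit_dom_real[OF proper A] by blast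
  have "eventually (\<lambda>t. (\<Psi> (A + t *\<^sub>R D) - \<Psi> A) / ereal t < ereal c) (at_right 0)"
    using order_tendstoD(2)[OF lim] \<open>l < c\<close> by simp
  moreover have "eventually (\<lambda>t::real. t > 0) (at_right 0)"
    by (rule eventually_at_right_less)
  ultimately show ?thesis
  proof eventually_elim
    case (elim t)
    then show ?case
      by (cases "\<Psi> (A + t *\<^sub>R D)") (auto simp: a field_simps)
  qed
qed

lemma crit_segment_le:
  assumes proper: "\<forall>M\<in>psd_matrices. \<Psi> M \<noteq> -\<infinity>" and conv: "strictly_convex_crit \<Psi>"
    and A: "A \<in> crit_dom \<Psi>" and B: "B \<in> crit_dom \<Psi>" and t: "0 < t" "t < 1"
  shows "\<Psi> (A + t *\<^sub>R (B - A)) \<le> \<Psi> A + ereal (t * (real_of_ereal (\<Psi> B) - real_of_ereal (\<Psi> A)))"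
proof -
  let ?C = "(1 - t) *\<^sub>R A + t *\<^sub>R B"
  define a b where "a = real_of_ereal (\<Psi> A)" and "b = real_of_ereal (\<Psi> B)"
  have a: "\<Psi> A = ereal a"
    unfolding a_def by (rule crit_dom_real[OF proper A])
  have C: "A + t *\<^sub>R (B - A) = ?C" by (simp add: algebra_simps)
  have "?C \<in> crit_dom \<Psi>"
    using conv[unfolded strictly_convex_crit_def, THEN conjunct1] A B t by (intro convexD) auto
  then have "\<Psi> ?C = ereal (real_of_ereal (\<Psi> ?C))"
    by (rule crit_dom_real[OF proper])
  moreover have "real_of_ereal (\<Psi> ?C) \<le> (1 - t) * real_of_ereal (\<Psi> A) + t * real_of_ereal (\<Psi> B)"
  proof (cases "A = B")
    case True
    then have "?C = A" by (simp add: algebra_simps)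
    then show ?thesis using True by (simp add: algebra_simps)
  next
    case False
    then show ?thesis
      using conv A B t unfolding strictly_convex_crit_def by (blast intro: less_imp_le)
  qed
  ultimately have "\<Psi> ?C \<le> ereal ((1 - t) * a + t * b)"
    by (metis a_def b_def ereal_less_eq(3))
  also have "(1 - t) * a + t * b = a + t * (b - a)" by (simp add: algebra_simps)
  finally show ?thesis
    unfolding C by (simp add: a flip: b_def)
qed

text \<open>Convexity makes every difference quotient on \<open>(0, 1)\<close> at most the full increment
  \<open>\<Psi> B - \<Psi> A\<close>, and this bound survives the limit \<open>t \<rightarrow> 0\<close>.\<close>

lemma crit_subgradient:
  assumes proper: "\<forall>M\<in>psd_matrices. \<Psi> M \<noteq> -\<infinity>" and conv: "strictly_convex_crit \<Psi>"
    and A: "A \<in> crit_dom \<Psi>" and B: "B \<in> psd_matrices"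
    and lim: "((\<lambda>t. (\<Psi> (A + t *\<^sub>R (B - A)) - \<Psi> A) / ereal t) \<longlongrightarrow> ereal l) (at_right 0)"
  shows "\<Psi> A + ereal l \<le> \<Psi> B"
proof (cases "B \<in> crit_dom \<Psi>")
  case False
  then show ?thesis using B by (auto simp: crit_dom_def)
next
  case True
  obtain a b where ab: "\<Psi> A = ereal a" "\<Psi> B = ereal b"
    using crit_dom_real[OF proper A] crit_dom_real[OF proper True] by blast
  have "eventually (\<lambda>t::real. t > 0) (at_right 0)"
    by (rule eventually_at_right_less)
  moreover have "eventually (\<lambda>t::real. t < 1) (at_right 0)"
    by (rule eventually_at_rightI[of 0 1]) auto
  ultimately have "eventually (\<lambda>t. (\<Psi> (A + t *\<^sub>R (B - A)) - \<Psi> A) / ereal t \<le> ereal (b - a)) (at_right 0)"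
  proof eventually_elim
    case (elim t)
    have "\<Psi> (A + t *\<^sub>R (B - A)) \<le> ereal a + ereal (t * (b - a))"
      using crit_segment_le[OF proper conv A True elim] by (simp add: ab)
    then show ?case
      using elim by (cases "\<Psi> (A + t *\<^sub>R (B - A))") (auto simp: ab field_simps)
  qed
  then have "ereal l \<le> ereal (b - a)"
    by (rule tendsto_upperbound[OF lim]) simp
  then show ?thesis by (simp add: ab)
qed

text \<open>A mean value inequality for one-sided derivatives. The set \<open>S\<close> of parameters at which \<open>\<Psi>\<close> lies
  below the line of slope \<open>- c\<close> contains its supremum by lower semicontinuity. The derivative at
  the supremum would extend \<open>S\<close> further to the right, so the supremum is \<open>t0\<close>. Membership
  in \<open>S\<close> entails membership in the domain of \<open>\<Psi>\<close>, so the slope need only be known at points of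
  the domain. The direction is always taken towards the endpoint \<open>B\<close>, because this is
  how the sensitivity function measures slopes.\<close>

lemma crit_descent_along_segment:
  assumes proper: "\<forall>M\<in>psd_matrices. \<Psi> M \<noteq> -\<infinity>" and lsc: "lsc_crit \<Psi>"
    and A: "A \<in> crit_dom \<Psi>" and B: "B \<in> psd_matrices" and t0: "0 \<le> t0" "t0 \<le> 1" and c: "0 \<le> c"
    and deriv: "\<And>t. \<lbrakk>0 \<le> t; t < t0; A + t *\<^sub>R (B - A) \<in> crit_dom \<Psi>\<rbrakk> \<Longrightarrow>
      \<exists>l < - c. ((\<lambda>s. (\<Psi> (A + t *\<^sub>R (B - A) + s *\<^sub>R (B - (A + t *\<^sub>R (B - A))))
        - \<Psi> (A + t *\<^sub>R (B - A))) / ereal s) \<longlongrightarrow> ereal l) (at_right 0)"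
  shows "\<Psi> (A + t0 *\<^sub>R (B - A)) \<le> \<Psi> A + ereal (- c * t0)"
proof -
  define \<gamma> where "\<gamma> t = A + t *\<^sub>R (B - A)" for t
  obtain a where a: "\<Psi> A = ereal a" using crit_dom_real[OF proper A] by blast
  have \<gamma>_psd: "\<gamma> t \<in> psd_matrices" if "0 \<le> t" "t \<le> 1" for t
    using A B that by (auto simp: \<gamma>_def crit_dom_def intro: segment_psd)
  define S where "S = {t. 0 \<le> t \<and> t \<le> t0 \<and> \<Psi> (\<gamma> t) \<le> ereal (a - c * t)}"
  define T where "T = Sup S"
  have S0: "0 \<in> S" using t0 by (auto simp: S_def \<gamma>_def a)
  have bdd: "bdd_above S" by (rule bdd_aboveI[of _ t0]) (auto simp: S_def)
  have T: "0 \<le> T"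
    unfolding T_def by (rule cSup_upper[OF S0 bdd])
  have T_le: "T \<le> t0"
    unfolding T_def using S0 by (intro cSup_least) (auto simp: S_def)
  have T_in: "T \<in> S"
  proof (rule ccontr)
    assume "T \<notin> S"
    then have "ereal (a - c * T) < \<Psi> (\<gamma> T)" using T T_le by (auto simp: S_def)
    then obtain y where y: "ereal (a - c * T) < ereal y" "ereal y < \<Psi> (\<gamma> T)"
      using ereal_dense2 by blast
    have "continuous_on UNIV \<gamma>" unfolding \<gamma>_def by (intro continuous_intros)
    then have "(\<gamma> \<longlongrightarrow> \<gamma> T) (nhds T)"
      by (simp add: continuous_on_eq_continuous_at isCont_def tendsto_nhds_iff)
    then have "eventually (\<lambda>t. \<gamma> t \<in> psd_matrices \<longrightarrow> ereal y < \<Psi> (\<gamma> t)) (nhds T)"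
      using eventually_compose_filterlim[OF lsc_crit_nhds[OF lsc _ y(2)]] \<gamma>_psd T T_le t0 by simp
    moreover have "((\<lambda>t. a - c * t) \<longlongrightarrow> a - c * T) (nhds T)"
      by (intro tendsto_intros filterlim_ident)
    then have "eventually (\<lambda>t. a - c * t < y) (nhds T)"
      using y(1) order_tendstoD(2) by simp
    ultimately have "eventually (\<lambda>t. t \<notin> S) (nhds T)"
    proof eventually_elim
      case (elim t)
      show ?case
      proof
        assume "t \<in> S"
        then have "ereal y < ereal (a - c * t)"
          using elim(1) \<gamma>_psd[of t] t0 less_le_trans[of "ereal y" "\<Psi> (\<gamma> t)" "ereal (a - c * t)"]
          by (simp add: S_def)
        then show False using elim(2) by simp
      qed
    qed
    then obtain e where e: "e > 0" "\<And>t. dist t T < e \<Longrightarrow> t \<notin> S"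
      by (auto simp: eventually_nhds_metric)
    obtain t where "t \<in> S" "T - e < t"
      using less_cSupD[of S "T - e"] S0 e(1) unfolding T_def by auto
    moreover have "t \<le> T" unfolding T_def by (rule cSup_upper[OF \<open>t \<in> S\<close> bdd])
    ultimately show False using e(2)[of t] by (simp add: dist_real_def)
  qed
  have "T = t0"
  proof (rule ccontr)
    assume "T \<noteq> t0"
    then have "T < t0" using T_le by simp
    have dom: "\<gamma> T \<in> crit_dom \<Psi>"
      using T_in \<gamma>_psd T T_le t0 by (auto simp: S_def crit_dom_def intro: le_less_trans)
    obtain g where g: "\<Psi> (\<gamma> T) = ereal g" using crit_dom_real[OF proper dom] by blast
    obtain l where l: "l < - c"
      "((\<lambda>s. (\<Psi> (\<gamma> T + s *\<^sub>R (B - \<gamma> T)) - \<Psi> (\<gamma> T)) / ereal s) \<longlongrightarrow> ereal l) (at_right 0)"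
      using deriv[OF T \<open>T < t0\<close>] dom unfolding \<gamma>_def by blast
    have "eventually (\<lambda>s. \<Psi> (\<gamma> T + s *\<^sub>R (B - \<gamma> T)) < \<Psi> (\<gamma> T) + ereal (- c * s)) (at_right 0)"
      by (rule crit_quotient_eventually_less[OF proper dom l(2,1)])
    moreover have "eventually (\<lambda>s. 0 < s \<and> s < t0 - T) (at_right 0)"
      using \<open>T < t0\<close> by (intro eventually_at_rightI[of 0 "t0 - T"]) auto
    ultimately have "eventually (\<lambda>s. \<Psi> (\<gamma> T + s *\<^sub>R (B - \<gamma> T)) < \<Psi> (\<gamma> T) + ereal (- c * s)
        \<and> 0 < s \<and> s < t0 - T) (at_right 0)"
      by eventually_elim simp
    then obtain s where s: "\<Psi> (\<gamma> T + s *\<^sub>R (B - \<gamma> T)) < \<Psi> (\<gamma> T) + ereal (- c * s)"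
      "0 < s" "s < t0 - T"
      using eventually_happens[of _ "at_right (0::real)"] by auto
    \<comment> \<open>The direction \<open>B - \<gamma> T\<close> is shorter than \<open>B - A\<close> by the factor \<open>1 - T\<close>, so a step \<open>s\<close> from \<open>\<gamma> T\<close>
      advances the parameter only by \<open>s * (1 - T)\<close>; the drop \<open>c * s\<close> is at least what membership in
      \<open>S\<close> asks for.\<close>
    define T' where "T' = T + s * (1 - T)"
    have eq: "\<gamma> T + s *\<^sub>R (B - \<gamma> T) = \<gamma> T'"
      by (simp add: \<gamma>_def T'_def algebra_simps)
    have T1: "T < 1" using \<open>T < t0\<close> t0 by simp
    have step: "0 < s * (1 - T)" "s * (1 - T) \<le> s"
      using s(2) T T1 by (auto simp: mult_le_cancel_left1)
    have "c * (s * (1 - T)) \<le> c * s" using step(2) c by (rule mult_left_mono)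
    moreover have "g \<le> a - c * T" using T_in g by (simp add: S_def)
    ultimately have "g + - c * s \<le> a - c * T'" by (simp add: T'_def algebra_simps)
    then have "\<Psi> (\<gamma> T') \<le> ereal (a - c * T')"
      using order.trans[OF less_imp_le[OF s(1)], of "ereal (a - c * T')"] unfolding eq g by simp
    then have "T' \<in> S" using step s(3) T by (simp add: S_def T'_def)
    then have "T' \<le> T" using cSup_upper[OF _ bdd] unfolding T_def by blast
    then show False using step by (simp add: T'_def)
  qed
  then show ?thesis using T_in by (simp add: S_def \<gamma>_def a)
qed

section \<open>Almost decreasing sequences and approximate solutions\<close>

text \<open>Subtracting the accumulated tolerances turns \<open>f\<close> into a decreasing sequence \<open>g\<close>, which
  loses at least \<open>a\<close> between consecutive indices of the subsequence and so cannot stay bounded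
  below along it.\<close>

lemma no_repeated_descent:
  fixes f \<delta> :: "nat \<Rightarrow> real" and r :: "nat \<Rightarrow> nat"
  assumes step: "\<And>k. f (Suc k) \<le> f k + \<delta> (Suc k)" and \<delta>: "\<And>k. 0 \<le> \<delta> k" "summable \<delta>"
    and r: "strict_mono r" and a: "a > 0"
    and descent: "\<And>j. f (Suc (r j)) \<le> f (r j) + \<delta> (Suc (r j)) - a"
    and lower: "\<And>j. L \<le> f (r j)"
  shows False
proof -
  define g where "g k = f k - (\<Sum>i\<le>k. \<delta> i)" for k
  have "g (Suc k) \<le> g k" for k
    using step[of k] by (simp add: g_def)
  then have g: "decseq g" by (rule decseq_SucI)
  have drop: "g (Suc (r j)) \<le> g (r j) - a" for j
    using descent[of j] by (simp add: g_def)
  have upper: "g (r n) \<le> g (r 0) - real n * a" for n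
  proof (induction n)
    case (Suc n)
    have "Suc (r n) \<le> r (Suc n)" using r by (simp add: strict_mono_def Suc_leI)
    then have "g (r (Suc n)) \<le> g (Suc (r n))" using decseqD[OF g] by blast
    then show ?case using drop[of n] Suc by (simp add: algebra_simps)
  qed simp
  have lower': "L - suminf \<delta> \<le> g (r n)" for n
    using lower[of n] sum_le_suminf[OF \<delta>(2), of "{..r n}"] \<delta>(1) by (simp add: g_def)
  obtain n where "g (r 0) - L + suminf \<delta> < real n * a"
    using reals_Archimedean3[OF a] by blast
  then show False using upper[of n] lower'[of n] by linarith
qed

lemma approx_solution_le:
  assumes "approx_solution f S \<delta> y" "z \<in> S"
  shows "f y \<le> f z + ereal \<delta>"
proof -
  have "f y \<le> (INF z\<in>S. f z) + ereal \<delta>" using assms(1) by (simp add: approx_solution_def)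
  also have "\<dots> \<le> f z + ereal \<delta>" using assms(2) by (intro add_right_mono INF_lower)
  finally show ?thesis .
qed

section \<open>Sensitivities, optimality and descent\<close>

locale design_problem =
  fixes X :: "'a::metric_space set"
    and m :: "'a \<Rightarrow> real^'n^'n"
    and \<Psi> :: "real^'n^'n \<Rightarrow> ereal"
    and \<psi> :: "real^'n^'n \<Rightarrow> 'a \<Rightarrow> real"
  assumes compact_X: "compact X"
    and cont_m: "continuous_on X m"
    and m_psd: "m ` X \<subseteq> psd_matrices"
    and proper: "\<forall>M\<in>psd_matrices. \<Psi> M \<noteq> -\<infinity>"
    and conv: "strictly_convex_crit \<Psi>"
    and lsc: "lsc_crit \<Psi>"
    and sens: "sensitivity_function X m \<Psi> \<psi>"
    and cont_sens: "continuous_on (crit_dom \<Psi> \<times> X) (\<lambda>(M, x). \<psi> M x)"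
begin

abbreviation \<M> :: "'a measure \<Rightarrow> real^'n^'n" where "\<M> \<equiv> info_matrix m"

lemma \<M>_psd: "\<eta> \<in> designs X \<Longrightarrow> \<M> \<eta> \<in> psd_matrices"
  by (rule info_matrix_psd[OF compact_X cont_m m_psd])

lemma \<M>_in_crit_dom: "\<eta> \<in> designs X \<Longrightarrow> \<Psi> (\<M> \<eta>) < \<infinity> \<Longrightarrow> \<M> \<eta> \<in> crit_dom \<Psi>"
  by (simp add: crit_dom_def \<M>_psd)

lemma \<M>_point_design:
  assumes "x \<in> X"
  shows "\<M> (point_design X x) = m x"
  unfolding info_matrix_def
  by (rule integral_point_design[OF assms borel_measurable_continuous_on_restrict[OF cont_m]])

text \<open>The sensitivity \<open>\<psi> A x\<close> is the slope of \<open>\<Psi>\<close> at \<open>A\<close> in the direction of \<open>m x\<close>, because \<open>m x\<close> is the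
  information matrix of the point mass at \<open>x\<close>.\<close>

lemma sens_toward_point:
  assumes A: "A \<in> crit_dom \<Psi>" and x: "x \<in> X"
  shows "((\<lambda>t. (\<Psi> (A + t *\<^sub>R (m x - A)) - \<Psi> A) / ereal t) \<longlongrightarrow> ereal (\<psi> A x)) (at_right 0)"
proof -
  note sens_point = sens[unfolded sensitivity_function_def, rule_format, OF A point_design_in_designs[OF x]]
  have lim: "((\<lambda>t. (\<Psi> (A + t *\<^sub>R (m x - A)) - \<Psi> A) / ereal t)
      \<longlongrightarrow> ereal (LINT y|point_design X x. \<psi> A y)) (at_right 0)"
    using sens_point[THEN conjunct2] unfolding \<M>_point_design[OF x] .
  have "integrable (point_design X x) (\<psi> A)"
    using sens_point by blast
  then have "\<psi> A \<in> borel_measurable (point_design X x)"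
    by (rule borel_measurable_integrable)
  then have "\<psi> A \<in> borel_measurable (restrict_space borel X)"
    unfolding measurable_cong_sets[OF sets_design[OF point_design_in_designs[OF x]] refl] .
  from lim[unfolded integral_point_design[OF x this]] show ?thesis .
qed

text \<open>This is the correctness of the stopping criterion: the average of sensitivities that are at
  least \<open>- \<epsilon>\<close> is at least \<open>- \<epsilon>\<close>, and convexity bounds the increment of \<open>\<Psi>\<close> from
  below by this average.\<close>

lemma eps_optimal_if_sens_bounded_below:
  assumes \<xi>: "\<xi> \<in> designs X" "\<Psi> (\<M> \<xi>) < \<infinity>" and bound: "\<And>y. y \<in> X \<Longrightarrow> - \<epsilon> \<le> \<psi> (\<M> \<xi>) y"
  shows "eps_optimal_design X m \<Psi> \<epsilon> \<xi>"
proof -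
  have dom: "\<M> \<xi> \<in> crit_dom \<Psi>" using \<xi> by (rule \<M>_in_crit_dom)
  obtain a where a: "\<Psi> (\<M> \<xi>) = ereal a" using crit_dom_real[OF proper dom] by blast
  have "ereal (a - \<epsilon>) \<le> \<Psi> (\<M> \<eta>)" if \<eta>: "\<eta> \<in> designs X" for \<eta>
  proof -
    interpret prob_space \<eta> using \<eta> by (rule prob_space_design)
    have int: "integrable \<eta> (\<psi> (\<M> \<xi>))"
      and lim: "((\<lambda>t. (\<Psi> (\<M> \<xi> + t *\<^sub>R (\<M> \<eta> - \<M> \<xi>)) - \<Psi> (\<M> \<xi>)) / ereal t)
        \<longlongrightarrow> ereal (LINT x|\<eta>. \<psi> (\<M> \<xi>) x)) (at_right 0)"
      using sens dom \<eta> by (auto simp: sensitivity_function_def)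
    have "- \<epsilon> \<le> (LINT x|\<eta>. \<psi> (\<M> \<xi>) x)"
      using integral_ge_const[OF int, of "- \<epsilon>"] bound space_design[OF \<eta>] by auto
    then have "ereal (a - \<epsilon>) \<le> \<Psi> (\<M> \<xi>) + ereal (LINT x|\<eta>. \<psi> (\<M> \<xi>) x)"
      by (simp add: a)
    also have "\<dots> \<le> \<Psi> (\<M> \<eta>)"
      by (rule crit_subgradient[OF proper conv dom \<M>_psd[OF \<eta>] lim])
    finally show ?thesis .
  qed
  then have "ereal (a - \<epsilon>) \<le> (INF \<eta>\<in>designs X. \<Psi> (\<M> \<eta>))" by (rule INF_greatest)
  then have "ereal (a - \<epsilon>) + ereal \<epsilon> \<le> (INF \<eta>\<in>designs X. \<Psi> (\<M> \<eta>)) + ereal \<epsilon>"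
    by (rule add_right_mono)
  then show ?thesis using \<xi>(1) by (simp add: eps_optimal_design_def a)
qed

text \<open>Every mixture of \<open>\<xi>\<close> with the point mass at the added point is feasible for the next
  discretized problem. The case \<open>t = 0\<close> says that the objective value cannot rise by more than the
  tolerance; positive \<open>t\<close> gives the progress of the step.\<close>

lemma exchange_step_le:
  assumes \<xi>: "\<xi> \<in> designs X" and x: "x \<in> X" and t: "0 \<le> t" "t \<le> 1"
    and approx: "approx_solution (\<lambda>\<eta>. \<Psi> (\<M> \<eta>)) (designs_in X (design_supp X \<xi> \<union> {x})) \<delta> \<xi>'"
  shows "\<Psi> (\<M> \<xi>') \<le> \<Psi> (\<M> \<xi> + t *\<^sub>R (m x - \<M> \<xi>)) + ereal \<delta>"
proof -
  note point = point_design_in_designs[OF x]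
  have "mixture t \<xi> (point_design X x) \<in> designs_in X (design_supp X \<xi> \<union> {x})"
    using mixture_in_designs[OF \<xi> point t] design_supp_mixture[OF \<xi> point t]
      design_supp_point_design[OF x]
    unfolding designs_in_def by blast
  from approx_solution_le[OF approx this] show ?thesis
    by (simp add: info_matrix_mixture[OF \<xi> point t compact_X cont_m] \<M>_point_design[OF x])
qed

text \<open>Near the limit pair \<open>(A', x')\<close> all slopes are below \<open>- c / 2\<close>. The segments have uniformly
  bounded direction vectors, so one parameter \<open>t\<close> keeps all of them inside this neighbourhood,
  and the descent estimate applies up to \<open>t\<close>.\<close>

lemma uniform_descent:
  assumes A: "\<And>k. A k \<in> crit_dom \<Psi>" "A \<longlonglongrightarrow> A'" "A' \<in> crit_dom \<Psi>"
    and x: "\<And>k. x k \<in> X" "x \<longlonglongrightarrow> x'" "x' \<in> X"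
    and B: "\<And>k. norm (A k) \<le> B" "\<And>y. y \<in> X \<Longrightarrow> norm (m y) \<le> B"
    and c: "0 < c" "\<And>k. \<psi> (A k) (x k) \<le> - c"
  obtains t where "0 < t" "t \<le> 1"
    "eventually (\<lambda>k. \<Psi> (A k + t *\<^sub>R (m (x k) - A k)) \<le> \<Psi> (A k) + ereal (- (c / 2) * t)) sequentially"
proof -
  have p': "(A', x') \<in> crit_dom \<Psi> \<times> X" using A x by simp
  have "((\<lambda>k. (\<lambda>(M, x). \<psi> M x) (A k, x k)) \<longlonglongrightarrow> (\<lambda>(M, x). \<psi> M x) (A', x'))"
    using A x by (intro continuous_on_tendsto_compose[OF cont_sens] tendsto_Pair p') auto
  then have lim: "\<psi> A' x' \<le> - c"
    using c(2) by (intro tendsto_upperbound[where f = "\<lambda>k. \<psi> (A k) (x k)"]) auto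
  obtain r where r: "r > 0" and r_near: "\<forall>p\<in>crit_dom \<Psi> \<times> X. dist p (A', x') < r
      \<longrightarrow> dist ((\<lambda>(M, x). \<psi> M x) p) ((\<lambda>(M, x). \<psi> M x) (A', x')) < c / 2"
    using cont_sens[unfolded continuous_on_iff, rule_format, OF p' half_gt_zero[OF c(1)]] by blast
  have near: "dist (\<psi> M y) (\<psi> A' x') < c / 2"
    if "M \<in> crit_dom \<Psi>" "y \<in> X" "dist (M, y) (A', x') < r" for M y
    using r_near[THEN bspec, of "(M, y)"] that by simp
  have B0: "0 \<le> B" using B(1)[of 0] norm_ge_zero order.trans by blast
  \<comment> \<open>All directions \<open>m (x k) - A k\<close> have norm at most \<open>2 * B\<close>, so steps up to \<open>t0\<close> move by at most
    \<open>r / 2\<close>; the rest of the radius \<open>r\<close> pays for the distances of \<open>A k\<close> and \<open>x k\<close> to their limits.\<close>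
  define t0 where "t0 = min 1 (r / (4 * (B + 1)))"
  have t0: "0 < t0" "t0 \<le> 1" using r B0 by (auto simp: t0_def)
  have t0_B: "t0 * (2 * B) \<le> r / 2"
  proof -
    have "t0 * (2 * B) \<le> r / (4 * (B + 1)) * (2 * (B + 1))"
      using r B0 by (intro mult_mono) (auto simp: t0_def)
    also have "\<dots> = r / 2" using B0 by (simp add: field_simps)
    finally show ?thesis .
  qed
  have "eventually (\<lambda>k. dist (A k) A' < r / 4) sequentially"
    "eventually (\<lambda>k. dist (x k) x' < r / 4) sequentially"
    using tendstoD[OF A(2), of "r / 4"] tendstoD[OF x(2), of "r / 4"] r by simp_all
  then have "eventually (\<lambda>k. \<Psi> (A k + t0 *\<^sub>R (m (x k) - A k)) \<le> \<Psi> (A k) + ereal (- (c / 2) * t0)) sequentially"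
  proof eventually_elim
    case (elim k)
    show ?case
    proof (rule crit_descent_along_segment[OF proper lsc A(1)])
      fix t
      assume t: "0 \<le> t" "t < t0" and dom: "A k + t *\<^sub>R (m (x k) - A k) \<in> crit_dom \<Psi>"
      have "norm (t *\<^sub>R (m (x k) - A k)) \<le> t0 * (2 * B)"
        unfolding norm_scaleR
      proof (rule mult_mono)
        show "norm (m (x k) - A k) \<le> 2 * B"
          using norm_triangle_ineq4[of "m (x k)" "A k"] B(1)[of k] B(2)[OF x(1)[of k]] by linarith
      qed (use t in auto)
      then have "dist (A k + t *\<^sub>R (m (x k) - A k)) (A k) \<le> r / 2"
        using t0_B by (simp add: dist_norm)
      then have "dist (A k + t *\<^sub>R (m (x k) - A k)) A' + dist (x k) x' < r"
        using elim dist_triangle[of "A k + t *\<^sub>R (m (x k) - A k)" A' "A k"] by linarith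
      then have close: "dist (A k + t *\<^sub>R (m (x k) - A k), x k) (A', x') < r"
        unfolding dist_Pair_Pair
        using sqrt_sum_squares_le_sum[of "dist (A k + t *\<^sub>R (m (x k) - A k)) A'" "dist (x k) x'"]
        by simp
      have "\<bar>\<psi> (A k + t *\<^sub>R (m (x k) - A k)) (x k) - \<psi> A' x'\<bar> < c / 2"
        using near[OF dom x(1) close] unfolding dist_real_def .
      then have slope: "\<psi> (A k + t *\<^sub>R (m (x k) - A k)) (x k) < - (c / 2)"
        using lim by linarith
      show "\<exists>l < - (c / 2). ((\<lambda>s. (\<Psi> (A k + t *\<^sub>R (m (x k) - A k)
            + s *\<^sub>R (m (x k) - (A k + t *\<^sub>R (m (x k) - A k))))
          - \<Psi> (A k + t *\<^sub>R (m (x k) - A k))) / ereal s) \<longlongrightarrow> ereal l) (at_right 0)"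
        by (rule exI[of _ "\<psi> (A k + t *\<^sub>R (m (x k) - A k)) (x k)"],
            rule conjI[OF slope sens_toward_point[OF dom x(1)]])
    qed (use m_psd x(1) t0 c in auto)
  qed
  with t0 show ?thesis by (rule that)
qed

text \<open>The objective values are bounded above by the initial value and the sum of the tolerances, so the
  limit of a subsequence of information matrices stays in the domain of \<open>\<Psi>\<close>. Uniform descent along this
  subsequence then contradicts the lower bound that lower semicontinuity provides at the limit.\<close>

lemma no_infinite_exchange:
  assumes \<xi>: "\<And>k. \<xi> k \<in> designs X" "\<And>k. \<Psi> (\<M> (\<xi> k)) < \<infinity>" and x: "\<And>k. x k \<in> X"
    and approx: "\<And>k. approx_solution (\<lambda>\<eta>. \<Psi> (\<M> \<eta>)) (designs_in X (design_supp X (\<xi> k) \<union> {x k}))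
      (\<delta> (Suc k)) (\<xi> (Suc k))"
    and \<delta>: "\<And>k. 0 \<le> \<delta> k" "summable \<delta>"
    and c: "0 < c" "eventually (\<lambda>k. \<psi> (\<M> (\<xi> k)) (x k) \<le> - c) sequentially"
  shows False
proof -
  have dom: "\<M> (\<xi> k) \<in> crit_dom \<Psi>" for k using \<xi> by (rule \<M>_in_crit_dom)
  define f where "f k = real_of_ereal (\<Psi> (\<M> (\<xi> k)))" for k
  have f: "\<Psi> (\<M> (\<xi> k)) = ereal (f k)" for k
    unfolding f_def by (rule crit_dom_real[OF proper dom])
  have step: "ereal (f (Suc k)) \<le> \<Psi> (\<M> (\<xi> k) + t *\<^sub>R (m (x k) - \<M> (\<xi> k))) + ereal (\<delta> (Suc k))"
    if "0 \<le> t" "t \<le> 1" for k t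
    using exchange_step_le[OF \<xi>(1) x that approx] by (simp add: f)
  have f_Suc: "f (Suc k) \<le> f k + \<delta> (Suc k)" for k
    using step[of 0 k] by (simp add: f)
  have f_le: "f k \<le> f 0 + suminf \<delta>" for k
  proof -
    have "f k \<le> f 0 + (\<Sum>i\<in>{1..k}. \<delta> i)"
    proof (induction k)
      case (Suc k)
      then show ?case using f_Suc[of k] by simp
    qed simp
    also have "(\<Sum>i\<in>{1..k}. \<delta> i) \<le> suminf \<delta>" using \<delta> by (intro sum_le_suminf) auto
    finally show ?thesis by simp
  qed
  obtain B where B: "\<And>y. y \<in> X \<Longrightarrow> norm (m y) \<le> B"
    using compact_imp_bounded[OF compact_continuous_image[OF cont_m compact_X]]
    by (auto simp: bounded_iff)
  have norm_B: "norm (\<M> (\<xi> k)) \<le> B" for k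
    using norm_info_matrix_le[OF compact_X cont_m \<xi>(1) B] by blast
  obtain N where N: "\<And>k. N \<le> k \<Longrightarrow> \<psi> (\<M> (\<xi> k)) (x k) \<le> - c"
    using c(2) by (auto simp: eventually_sequentially)
  have "compact (cball (0 :: real^'n^'n) B \<times> X)" using compact_X by (intro compact_Times compact_cball)
  moreover have "(\<M> (\<xi> (k + N)), x (k + N)) \<in> cball 0 B \<times> X" for k
    using norm_B x by simp
  ultimately have "\<exists>p\<in>cball 0 B \<times> X. \<exists>r. strict_mono r \<and>
      ((\<lambda>k. (\<M> (\<xi> (k + N)), x (k + N))) \<circ> r) \<longlonglongrightarrow> p"
    unfolding compact_def by simp
  then obtain p r where "strict_mono r" and p: "p \<in> cball 0 B \<times> X"
    and lim: "((\<lambda>k. (\<M> (\<xi> (k + N)), x (k + N))) \<circ> r) \<longlonglongrightarrow> p"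
    by blast
  define A' x' where "A' = fst p" and "x' = snd p"
  \<comment> \<open>Only indices from \<open>N\<close> on are used, where the slope bound holds.\<close>
  define q where "q j = r j + N" for j
  have q: "strict_mono q" using \<open>strict_mono r\<close> by (simp add: q_def strict_mono_def)
  have lim_A: "(\<lambda>j. \<M> (\<xi> (q j))) \<longlonglongrightarrow> A'" and lim_x: "(\<lambda>j. x (q j)) \<longlonglongrightarrow> x'"
    using tendsto_fst[OF lim] tendsto_snd[OF lim] by (simp_all add: A'_def x'_def q_def o_def)
  have x': "x' \<in> X" using p by (auto simp: x'_def)
  have A'_psd: "A' \<in> psd_matrices"
    using closed_sequentially[OF closed_psd_matrices _ lim_A] \<M>_psd \<xi>(1) by blast
  note lsc_A' = lsc_crit_sequentially[OF lsc A'_psd _ lim_A \<M>_psd[OF \<xi>(1)]]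
  have "\<not> ereal (f 0 + suminf \<delta>) < \<Psi> A'"
  proof
    assume "ereal (f 0 + suminf \<delta>) < \<Psi> A'"
    then have "eventually (\<lambda>j. f 0 + suminf \<delta> < f (q j)) sequentially"
      using lsc_A'[of "ereal (f 0 + suminf \<delta>)"] by (simp add: f)
    then obtain j where "f 0 + suminf \<delta> < f (q j)"
      by (auto simp: eventually_sequentially)
    then show False using f_le[of "q j"] by simp
  qed
  then have A'_dom: "A' \<in> crit_dom \<Psi>"
    using A'_psd by (auto simp: crit_dom_def)
  have q_sens: "\<psi> (\<M> (\<xi> (q j))) (x (q j)) \<le> - c" for j
    using N by (simp add: q_def)
  obtain t where t: "0 < t" "t \<le> 1"
    and descent: "eventually (\<lambda>j. \<Psi> (\<M> (\<xi> (q j)) + t *\<^sub>R (m (x (q j)) - \<M> (\<xi> (q j))))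
      \<le> \<Psi> (\<M> (\<xi> (q j))) + ereal (- (c / 2) * t)) sequentially"
    using uniform_descent[OF dom lim_A A'_dom x lim_x x' norm_B B c(1) q_sens] by blast
  obtain L where L: "\<Psi> A' = ereal L" using crit_dom_real[OF proper A'_dom] by blast
  have "eventually (\<lambda>j. L - 1 < f (q j)) sequentially"
    using lsc_A'[of "ereal (L - 1)"] by (simp add: L f)
  with descent have "eventually (\<lambda>j. f (Suc (q j)) \<le> f (q j) + \<delta> (Suc (q j)) - c / 2 * t \<and> L - 1 \<le> f (q j)) sequentially"
  proof eventually_elim
    case (elim j)
    have "ereal (f (Suc (q j))) \<le> ereal (f (q j)) + ereal (- (c / 2) * t) + ereal (\<delta> (Suc (q j)))"
      using order.trans[OF step[of t "q j"] add_right_mono[OF elim(1)]] t by (simp add: f)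
    then show ?case using elim(2) by simp
  qed
  then obtain J where J: "\<And>j. J \<le> j \<Longrightarrow>
      f (Suc (q j)) \<le> f (q j) + \<delta> (Suc (q j)) - c / 2 * t \<and> L - 1 \<le> f (q j)"
    by (auto simp: eventually_sequentially)
  show False
  proof (rule no_repeated_descent[of f \<delta> "\<lambda>j. q (j + J)" "c / 2 * t" "L - 1"])
    show "strict_mono (\<lambda>j. q (j + J))" using q by (simp add: strict_mono_def)
  qed (use f_Suc \<delta> J c t in auto)
qed

end

section \<open>Runs of the exchange algorithms\<close>

text \<open>What the strict and the relaxed algorithm have in common: a step is taken only at a point with
  sensitivity below \<open>- \<epsilon> + \<theta> k\<close>, and the algorithm stops only if no sensitivity is below \<open>- \<epsilon>\<close>.\<close>

definition exchange_run ::
  "'a::metric_space set \<Rightarrow> ('a \<Rightarrow> real^'n^'n) \<Rightarrow> (real^'n^'n \<Rightarrow> ereal)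
     \<Rightarrow> (real^'n^'n \<Rightarrow> 'a \<Rightarrow> real) \<Rightarrow> 'a set \<Rightarrow> real \<Rightarrow> (nat \<Rightarrow> real) \<Rightarrow> (nat \<Rightarrow> real)
     \<Rightarrow> nat set \<Rightarrow> (nat \<Rightarrow> 'a measure) \<Rightarrow> bool" where
  "exchange_run X m \<Psi> \<psi> X0 \<epsilon> \<delta> \<theta> K \<xi> \<longleftrightarrow>
     (\<exists>Xs x. Xs 0 = X0 \<and> 0 \<in> K \<and> (\<forall>k. Suc k \<in> K \<longrightarrow> k \<in> K) \<and>
        (\<forall>k\<in>K.
           approx_solution (\<lambda>\<eta>. \<Psi> (info_matrix m \<eta>)) (designs_in X (Xs k)) (\<delta> k) (\<xi> k) \<and>
           (Suc k \<in> K \<longrightarrow> x k \<in> X \<and> \<psi> (info_matrix m (\<xi> k)) (x k) < - \<epsilon> + \<theta> k \<and>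
              Xs (Suc k) = design_supp X (\<xi> k) \<union> {x k}) \<and>
           (Suc k \<notin> K \<longrightarrow> (\<forall>y\<in>X. - \<epsilon> \<le> \<psi> (info_matrix m (\<xi> k)) y))))"

text \<open>On termination the approximate minimizer \<open>x k\<close> has sensitivity at least \<open>- \<epsilon> + \<delta>l k\<close>, and no other
  point can be lower by more than \<open>\<delta>l k\<close>.\<close>

lemma strict_run_imp_exchange_run:
  assumes "strict_exchange_run X m \<Psi> \<psi> X0 \<epsilon> \<delta>u \<delta>l K \<xi>"
  shows "exchange_run X m \<Psi> \<psi> X0 \<epsilon> \<delta>u \<delta>l K \<xi>"
proof -
  obtain Xs x where run: "Xs 0 = X0" "0 \<in> K" "\<forall>k. Suc k \<in> K \<longrightarrow> k \<in> K"
    and body: "\<forall>k\<in>K.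
      approx_solution (\<lambda>\<eta>. \<Psi> (info_matrix m \<eta>)) (designs_in X (Xs k)) (\<delta>u k) (\<xi> k) \<and>
      approx_solution (\<lambda>y. ereal (\<psi> (info_matrix m (\<xi> k)) y)) X (\<delta>l k) (x k) \<and>
      (if \<psi> (info_matrix m (\<xi> k)) (x k) < - \<epsilon> + \<delta>l k
       then Suc k \<in> K \<and> Xs (Suc k) = design_supp X (\<xi> k) \<union> {x k} else Suc k \<notin> K)"
    using assms unfolding strict_exchange_run_def by (elim exE conjE) (rule that)
  note sol = body[THEN bspec, THEN conjunct1]
    and point = body[THEN bspec, THEN conjunct2, THEN conjunct1]
    and branch = body[THEN bspec, THEN conjunct2, THEN conjunct2]
  have "x k \<in> X" if "k \<in> K" for k
    using point[OF that] by (simp add: approx_solution_def)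
  moreover have "\<psi> (info_matrix m (\<xi> k)) (x k) < - \<epsilon> + \<delta>l k
      \<and> Xs (Suc k) = design_supp X (\<xi> k) \<union> {x k}" if "k \<in> K" "Suc k \<in> K" for k
    using branch[OF that(1)] that(2) by (simp split: if_splits)
  moreover have "- \<epsilon> \<le> \<psi> (info_matrix m (\<xi> k)) y" if "k \<in> K" "Suc k \<notin> K" "y \<in> X" for k y
  proof -
    have "- \<epsilon> + \<delta>l k \<le> \<psi> (info_matrix m (\<xi> k)) (x k)"
      using branch[OF that(1)] that(2) by (simp split: if_splits)
    moreover have "\<psi> (info_matrix m (\<xi> k)) (x k) \<le> \<psi> (info_matrix m (\<xi> k)) y + \<delta>l k"
      using approx_solution_le[OF point[OF that(1)] that(3)] by simp
    ultimately show ?thesis by simp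
  qed
  ultimately show ?thesis
    using run sol unfolding exchange_run_def
    by (intro exI[of _ Xs] exI[of _ x] conjI ballI impI) blast+
qed

lemma relaxed_run_imp_exchange_run:
  assumes "relaxed_exchange_run X m \<Psi> \<psi> X0 \<epsilon> \<delta>u K \<xi>"
  shows "exchange_run X m \<Psi> \<psi> X0 \<epsilon> \<delta>u (\<lambda>_. 0) K \<xi>"
proof -
  obtain Xs x where run: "Xs 0 = X0" "0 \<in> K" "\<forall>k. Suc k \<in> K \<longrightarrow> k \<in> K"
    and body: "\<forall>k\<in>K.
      approx_solution (\<lambda>\<eta>. \<Psi> (info_matrix m \<eta>)) (designs_in X (Xs k)) (\<delta>u k) (\<xi> k) \<and>
      (if {y \<in> X. \<psi> (info_matrix m (\<xi> k)) y < - \<epsilon>} \<noteq> {}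
       then x k \<in> {y \<in> X. \<psi> (info_matrix m (\<xi> k)) y < - \<epsilon>} \<and>
         Suc k \<in> K \<and> Xs (Suc k) = design_supp X (\<xi> k) \<union> {x k}
       else Suc k \<notin> K)"
    using assms unfolding relaxed_exchange_run_def by (elim exE conjE) (rule that)
  note sol = body[THEN bspec, THEN conjunct1]
    and branch = body[THEN bspec, THEN conjunct2]
  have "x k \<in> X \<and> \<psi> (info_matrix m (\<xi> k)) (x k) < - \<epsilon> + 0
      \<and> Xs (Suc k) = design_supp X (\<xi> k) \<union> {x k}" if "k \<in> K" "Suc k \<in> K" for k
    using branch[OF that(1)] that(2) by (simp split: if_splits)
  moreover have "- \<epsilon> \<le> \<psi> (info_matrix m (\<xi> k)) y" if "k \<in> K" "Suc k \<notin> K" "y \<in> X" for k y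
  proof (rule ccontr)
    assume "\<not> - \<epsilon> \<le> \<psi> (info_matrix m (\<xi> k)) y"
    then have "{y \<in> X. \<psi> (info_matrix m (\<xi> k)) y < - \<epsilon>} \<noteq> {}" using that(3) by auto
    then show False using branch[OF that(1)] that(2) by simp
  qed
  ultimately show ?thesis
    using run sol unfolding exchange_run_def
    by (intro exI[of _ Xs] exI[of _ x] conjI ballI impI) blast+
qed

lemma (in design_problem) exchange_run_terminates:
  assumes X0: "designs_fin X m \<Psi> X0 \<noteq> {}"
    and \<delta>: "\<And>k. 0 \<le> \<delta> k" "summable \<delta>"
    and \<theta>: "limsup (\<lambda>k. ereal (\<theta> k)) < ereal \<epsilon>"
    and "exchange_run X m \<Psi> \<psi> X0 \<epsilon> \<delta> \<theta> K \<xi>"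
  shows "\<exists>k. K = {..k} \<and> eps_optimal_design X m \<Psi> \<epsilon> (\<xi> k)"
proof -
  obtain Xs x where start: "Xs 0 = X0" "0 \<in> K" and pred: "\<forall>k. Suc k \<in> K \<longrightarrow> k \<in> K"
    and body: "\<forall>k\<in>K. approx_solution (\<lambda>\<eta>. \<Psi> (\<M> \<eta>)) (designs_in X (Xs k)) (\<delta> k) (\<xi> k) \<and>
      (Suc k \<in> K \<longrightarrow> x k \<in> X \<and> \<psi> (\<M> (\<xi> k)) (x k) < - \<epsilon> + \<theta> k \<and>
        Xs (Suc k) = design_supp X (\<xi> k) \<union> {x k}) \<and>
      (Suc k \<notin> K \<longrightarrow> (\<forall>y\<in>X. - \<epsilon> \<le> \<psi> (\<M> (\<xi> k)) y))"
    using assms(5) unfolding exchange_run_def by (elim exE conjE) (rule that)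
  note run = start pred[rule_format]
    and sol = body[THEN bspec, THEN conjunct1]
    and go_on = body[THEN bspec, THEN conjunct2, THEN conjunct1, THEN mp]
    and stop = body[THEN bspec, THEN conjunct2, THEN conjunct2, THEN mp, THEN bspec]
  have \<xi>: "\<xi> k \<in> designs X" if "k \<in> K" for k
    using sol[OF that] by (simp add: approx_solution_def designs_in_def)
  have next_sol: "approx_solution (\<lambda>\<eta>. \<Psi> (\<M> \<eta>)) (designs_in X (design_supp X (\<xi> k) \<union> {x k}))
      (\<delta> (Suc k)) (\<xi> (Suc k))" if "Suc k \<in> K" for k
    using sol[OF that] go_on[OF run(3)[OF that] that] by simp
  have fin: "\<Psi> (\<M> (\<xi> k)) < \<infinity>" if "k \<in> K" for k
    using that
  proof (induction k)
    case 0
    obtain \<eta> where "\<eta> \<in> designs_in X X0" "\<Psi> (\<M> \<eta>) < \<infinity>"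
      using X0 by (auto simp: designs_fin_def)
    then show ?case
      using approx_solution_le[OF sol[OF 0], of \<eta>] run(1) by (auto simp: le_less_trans)
  next
    case (Suc k)
    have "\<Psi> (\<M> (\<xi> (Suc k))) \<le> \<Psi> (\<M> (\<xi> k)) + ereal (\<delta> (Suc k))"
      using exchange_step_le[OF \<xi>[OF run(3)[OF Suc.prems]] _ _ _ next_sol[OF Suc.prems], of 0]
        go_on[OF run(3)[OF Suc.prems] Suc.prems] by simp
    also have "\<dots> < \<infinity>" using Suc.IH[OF run(3)[OF Suc.prems]] by simp
    finally show ?case .
  qed
  show ?thesis
  proof (cases "\<exists>k\<in>K. Suc k \<notin> K")
    case True
    then obtain k where k: "k \<in> K" "Suc k \<notin> K" by blast
    have down: "j \<in> K" if "j \<le> i" "i \<in> K" for i j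
      using that by (induction rule: inc_induct) (auto intro: run(3))
    have "K = {..k}"
    proof
      show "{..k} \<subseteq> K" using down k(1) by blast
      show "K \<subseteq> {..k}" using down k(2) by (metis atMost_iff not_less_eq_eq subsetI)
    qed
    moreover have "eps_optimal_design X m \<Psi> \<epsilon> (\<xi> k)"
      using eps_optimal_if_sens_bounded_below[OF \<xi> fin] stop k by blast
    ultimately show ?thesis by blast
  next
    case False
    have K: "k \<in> K" for k by (induction k) (use False run(2) in auto)
    \<comment> \<open>The gap \<open>\<epsilon> - s\<close> serves as the bound \<open>c\<close> on the steepness of all late steps.\<close>
    obtain s where s: "limsup (\<lambda>k. ereal (\<theta> k)) < ereal s" "s < \<epsilon>"
      using ereal_dense2[OF \<theta>] by auto
    have "eventually (\<lambda>k. \<theta> k < s) sequentially"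
      using Limsup_lessD[OF s(1)] by simp
    then have "eventually (\<lambda>k. \<psi> (\<M> (\<xi> k)) (x k) \<le> - (\<epsilon> - s)) sequentially"
    proof eventually_elim
      case (elim k)
      then show ?case using go_on[OF K K, of k] by simp
    qed
    then show ?thesis
      using no_infinite_exchange[of \<xi> x \<delta> "\<epsilon> - s"] \<xi> fin K go_on next_sol \<delta> s(2) by simp
  qed
qed

theorem theorem3p14:
  fixes X X0 :: "'a::metric_space set"
    and m :: "'a \<Rightarrow> real^'n^'n"
    and \<Psi> :: "real^'n^'n \<Rightarrow> ereal"
    and \<psi> :: "real^'n^'n \<Rightarrow> 'a \<Rightarrow> real"
    and \<epsilon> :: real
    and \<delta>u \<delta>l :: "nat \<Rightarrow> real"
    and K :: "nat set"
    and \<xi> :: "nat \<Rightarrow> 'a measure"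
  assumes "compact X"
    and "continuous_on X m" and "m ` X \<subseteq> psd_matrices"
    and "\<forall>M\<in>psd_matrices. \<Psi> M \<noteq> -\<infinity>"
    and "strictly_convex_crit \<Psi>"
    and "lsc_crit \<Psi>"
    and "designs_fin X m \<Psi> X \<noteq> {}"
    and "sensitivity_function X m \<Psi> \<psi>"
    and "continuous_on (crit_dom \<Psi> \<times> X) (\<lambda>(M, x). \<psi> M x)"
    and "finite X0" and "X0 \<subseteq> X"
    and "designs_fin X m \<Psi> X0 \<noteq> {}"
    and "\<epsilon> > 0"
    and "\<forall>k. 0 \<le> \<delta>u k" and "\<forall>k. 0 \<le> \<delta>l k"
    and "summable \<delta>u"
    and "limsup (\<lambda>k. ereal (\<delta>l k)) < ereal \<epsilon>"
    and "strict_exchange_run X m \<Psi> \<psi> X0 \<epsilon> \<delta>u \<delta>l K \<xi> \<or>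
         relaxed_exchange_run X m \<Psi> \<psi> X0 \<epsilon> \<delta>u K \<xi>"
  shows "\<exists>k. K = {..k} \<and> eps_optimal_design X m \<Psi> \<epsilon> (\<xi> k)"
proof -
  interpret design_problem X m \<Psi> \<psi>
    by (rule design_problem.intro; fact)
  note terminates = exchange_run_terminates[OF \<open>designs_fin X m \<Psi> X0 \<noteq> {}\<close>
      \<open>\<forall>k. 0 \<le> \<delta>u k\<close>[rule_format] \<open>summable \<delta>u\<close>]
  show ?thesis
    using \<open>strict_exchange_run X m \<Psi> \<psi> X0 \<epsilon> \<delta>u \<delta>l K \<xi> \<or>
      relaxed_exchange_run X m \<Psi> \<psi> X0 \<epsilon> \<delta>u K \<xi>\<close>
  proof
    assume "strict_exchange_run X m \<Psi> \<psi> X0 \<epsilon> \<delta>u \<delta>l K \<xi>"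
    then show ?thesis
      by (rule terminates[OF \<open>limsup (\<lambda>k. ereal (\<delta>l k)) < ereal \<epsilon>\<close> strict_run_imp_exchange_run])
  next
    have "limsup (\<lambda>k. ereal 0) < ereal \<epsilon>"
      using \<open>\<epsilon> > 0\<close> by (simp add: Limsup_const)
    moreover assume "relaxed_exchange_run X m \<Psi> \<psi> X0 \<epsilon> \<delta>u K \<xi>"
    ultimately show ?thesis
      by (rule terminates[OF _ relaxed_run_imp_exchange_run])
  qed
qed

end
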